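(* Let $H$ be any complex Hilbert space with $\dim H\ge 4$. Then there exists a triple $\mathcal T=(T_1,T_2,T_3)$ of mutually commuting bounded linear operators on $H$ such that the joint numerical range $$W(\mathcal T)=\{(\langle T_1x,x\rangle,\langle T_2x,x\rangle,\langle T_3x,x\rangle): x\in H,\ \|x\|=1\}\subset\mathbb C^3$$ is not convex.
   Context: Mutually commuting means $T_jT_k=T_kT_j$ for all $j,k$. Convexity of a subset of $\mathbb C^n$ is the usual (real) convexity: $tu+(1-t)v$ belongs to the set whenever $u,v$ do and $t\in[0,1]$. *)

theory Defs
  imports "HOL-Analysis.Analysis" "HOL-Library.Extended_Nat"
begin

class complex_vector = real_vector +
  fixes scaleC :: "complex \<Rightarrow> 'a \<Rightarrow> 'a" (infixr \<open>*\<^sub>C\<close> 75)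
  assumes scaleC_add_right: "a *\<^sub>C (x + y) = a *\<^sub>C x + a *\<^sub>C y"
    and scaleC_add_left: "(a + b) *\<^sub>C x = a *\<^sub>C x + b *\<^sub>C x"
    and scaleC_scaleC: "a *\<^sub>C (b *\<^sub>C x) = (a * b) *\<^sub>C x"
    and scaleC_one: "1 *\<^sub>C x = x"
    and scaleR_scaleC: "r *\<^sub>R x = complex_of_real r *\<^sub>C x"

global_interpretation complex_vector: vector_space "scaleC :: complex \<Rightarrow> 'a \<Rightarrow> 'a::complex_vector"
  by unfold_locales
    (simp_all add: scaleC_add_right scaleC_add_left scaleC_scaleC scaleC_one)

text \<open>The inner product is linear in its first and conjugate-linear in its second argument.
  The norm axioms inherited from \<^class>\<open>real_normed_vector\<close> are redundant, since the norm is
  required to be the one induced by the inner product.\<close>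

class complex_inner = complex_vector + real_normed_vector +
  fixes cinner :: "'a \<Rightarrow> 'a \<Rightarrow> complex"
  assumes cinner_commute: "cinner x y = cnj (cinner y x)"
    and cinner_add_left: "cinner (x + y) z = cinner x z + cinner y z"
    and cinner_scaleC_left: "cinner (c *\<^sub>C x) y = c * cinner x y"
    and cinner_self_nonneg: "0 \<le> Re (cinner x x)"
    and cinner_self_eq_zero_iff: "cinner x x = 0 \<longleftrightarrow> x = 0"
    and norm_eq_sqrt_cinner: "norm x = sqrt (Re (cinner x x))"

class chilbert_space = complex_inner + banach

text \<open>The library's \<^term>\<open>complex_vector.dim\<close> is a natural number and returns \<open>0\<close> on
  infinite-dimensional spaces; here these get dimension \<open>\<infinity>\<close>.\<close>

definition cdim :: "'a::complex_vector set \<Rightarrow> enat" where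
  "cdim V = (if \<exists>B. finite B \<and> V \<subseteq> complex_vector.span B
             then enat (complex_vector.dim V) else \<infinity>)"

definition bounded_clinear :: "('a::complex_inner \<Rightarrow> 'b::complex_inner) \<Rightarrow> bool" where
  "bounded_clinear f \<longleftrightarrow>
     Vector_Spaces.linear scaleC scaleC f \<and> (\<exists>K. \<forall>x. norm (f x) \<le> K * norm x)"

definition joint_numerical_range ::
    "('n::finite \<Rightarrow> 'a::complex_inner \<Rightarrow> 'a) \<Rightarrow> (complex ^ 'n) set" where
  "joint_numerical_range T = {(\<chi> j. cinner (T j x) x) | x. norm x = 1}"

end

(* For orthonormal a, b, c, d take the rank-one operators sending c to a, d to a and c to b.
  All products vanish, since {a, b} is orthogonal to {c, d}.  The values at x are
  p * cnj u, q * cnj u, p * cnj v with u, v, p, q the coordinates of x along a, b, c, d.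
  The range contains (0, 1/2, 0) and (0, 0, 1/2), attained at (a + d) / sqrt 2 and
  (b + c) / sqrt 2, but not their midpoint (0, 1/4, 1/4): nonzero second and third values
  force u and p, hence the first value, to be nonzero. *)

theory Submission
  imports Defs
begin

lemma cinner_add_right: "cinner (x :: 'a::complex_inner) (y + z) = cinner x y + cinner x z"
  by (metis cinner_add_left cinner_commute complex_cnj_add)

lemma cinner_scaleC_right: "cinner (x :: 'a::complex_inner) (c *\<^sub>C y) = cnj c * cinner x y"
  by (metis cinner_scaleC_left cinner_commute complex_cnj_mult)

lemma cinner_zero_left [simp]: "cinner 0 (y :: 'a::complex_inner) = 0"
  using cinner_add_left[of 0 0 y] by simp

lemma cinner_zero_right [simp]: "cinner (x :: 'a::complex_inner) 0 = 0"
  using cinner_add_right[of x 0 0] by simp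

lemma cinner_diff_left: "cinner ((x :: 'a::complex_inner) - y) z = cinner x z - cinner y z"
  using cinner_add_left[of "x - y" y z] by simp

lemma cinner_diff_right: "cinner (x :: 'a::complex_inner) (y - z) = cinner x y - cinner x z"
  using cinner_add_right[of x "y - z" z] by simp

lemma cinner_sum_left: "cinner (\<Sum>i\<in>I. f i) (y :: 'a::complex_inner) = (\<Sum>i\<in>I. cinner (f i) y)"
  by (induction I rule: infinite_finite_induct) (simp_all add: cinner_add_left)

lemma cinner_self_norm: "cinner (x :: 'a::complex_inner) x = complex_of_real ((norm x)\<^sup>2)"
proof -
  have "Im (cinner x x) = 0"
    using arg_cong[OF cinner_commute[of x x], of Im] by simp
  then show ?thesis
    using cinner_self_nonneg[of x] by (simp add: complex_eq_iff norm_eq_sqrt_cinner)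
qed

text \<open>The class gives homogeneity of the norm for real scalars only; the complex case comes
  from comparing squared norms through the inner product.\<close>

lemma norm_scaleC: "norm (c *\<^sub>C (x :: 'a::complex_inner)) = cmod c * norm x"
proof -
  have "complex_of_real ((norm (c *\<^sub>C x))\<^sup>2) = c * cnj c * cinner x x"
    unfolding cinner_self_norm[symmetric] by (simp add: cinner_scaleC_left cinner_scaleC_right)
  also have "\<dots> = complex_of_real ((cmod c * norm x)\<^sup>2)"
    by (simp add: cinner_self_norm power_mult_distrib flip: complex_norm_square)
  finally have "(norm (c *\<^sub>C x))\<^sup>2 = (cmod c * norm x)\<^sup>2"
    by (simp only: of_real_eq_iff)
  then show ?thesis
    by (simp add: power2_eq_iff_nonneg)
qed

lemma cinner_Cauchy_Schwarz: "cmod (cinner (x :: 'a::complex_inner) y) \<le> norm x * norm y"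
proof (cases "norm y = 0")
  case True
  then show ?thesis
    using cinner_self_norm[of y] cinner_self_eq_zero_iff[of y] by simp
next
  case False
  \<comment> \<open>\<open>z\<close> is the component of \<open>x\<close> orthogonal to
    \<open>y\<close>, scaled by \<open>cinner y y\<close> to avoid division. Nonnegativity of
    \<open>cinner z z\<close> is then the squared inequality times the positive factor
    \<open>(norm y)\<^sup>2\<close>.\<close>
  define z where "z = cinner y y *\<^sub>C x - cinner x y *\<^sub>C y"
  have "cinner z z = cinner y y * (cinner x x * cinner y y - cinner x y * cnj (cinner x y))"
    using cinner_commute[of y x] cinner_commute[of y y]
    by (simp add: z_def cinner_diff_left cinner_diff_right cinner_scaleC_left
        cinner_scaleC_right algebra_simps)
  also have "\<dots> = complex_of_real ((norm y)\<^sup>2 * ((norm x * norm y)\<^sup>2 - (cmod (cinner x y))\<^sup>2))"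
    by (simp add: cinner_self_norm power_mult_distrib flip: complex_norm_square)
  finally have "0 \<le> (norm y)\<^sup>2 * ((norm x * norm y)\<^sup>2 - (cmod (cinner x y))\<^sup>2)"
    using cinner_self_nonneg[of z] by simp
  then have "(cmod (cinner x y))\<^sup>2 \<le> (norm x * norm y)\<^sup>2"
    using False by (simp add: zero_le_mult_iff)
  then show ?thesis
    by (rule power2_le_imp_le) (simp add: norm_eq_sqrt_cinner cinner_self_nonneg)
qed

lemma bounded_clinear_rank_one:
  fixes a b :: "'a::complex_inner"
  shows "bounded_clinear (\<lambda>x. cinner x b *\<^sub>C a)"
  unfolding bounded_clinear_def
proof (intro conjI exI allI)
  show "Vector_Spaces.linear scaleC scaleC (\<lambda>x. cinner x b *\<^sub>C a)"
    by unfold_locales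
      (simp_all add: cinner_add_left cinner_scaleC_left scaleC_add_left scaleC_scaleC)
  show "norm (cinner x b *\<^sub>C a) \<le> (norm b * norm a) * norm x" for x
    using mult_right_mono[OF cinner_Cauchy_Schwarz[of x b], of "norm a"]
    by (simp add: norm_scaleC mult_ac)
qed

text \<open>As a predicate on sets it cannot see repetitions in a listing such as
  \<open>{a, b, c, d}\<close>, so distinctness is supplied separately, by \<open>distinct\<close> or
  by the cardinality.\<close>

definition orthonormal :: "'a::complex_inner set \<Rightarrow> bool" where
  "orthonormal S \<longleftrightarrow> (\<forall>x\<in>S. \<forall>y\<in>S. cinner x y = (if x = y then 1 else 0))"

text \<open>One Gram-Schmidt step. The bound on \<open>card S\<close> guarantees a vector outside
  the span of \<open>S\<close>, in finite and infinite dimension alike: a finite spanning set would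
  make \<open>cdim\<close> finite and at most \<open>card S\<close>.\<close>

lemma orthonormal_extend:
  fixes S :: "'a::complex_inner set"
  assumes "finite S" "orthonormal S" "enat (card S) < cdim (UNIV :: 'a set)"
  obtains e where "e \<notin> S" "orthonormal (insert e S)"
proof -
  have "\<not> UNIV \<subseteq> complex_vector.span S"
  proof
    assume span: "UNIV \<subseteq> complex_vector.span S"
    then have "cdim (UNIV :: 'a set) = enat (complex_vector.dim (UNIV :: 'a set))"
      using \<open>finite S\<close> by (auto simp: cdim_def)
    then show False
      using assms(3) complex_vector.dim_le_card[OF span \<open>finite S\<close>] by simp
  qed
  then obtain y where y: "y \<notin> complex_vector.span S"
    by blast
  \<comment> \<open>Subtracting the orthogonal projection of \<open>y\<close> onto the span of
    \<open>S\<close> leaves a residual orthogonal to \<open>S\<close>; it is nonzero because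
    \<open>y\<close> lies outside that span.\<close>
  define z where "z = y - (\<Sum>s\<in>S. cinner y s *\<^sub>C s)"
  have "z \<noteq> 0"
  proof
    assume "z = 0"
    moreover have "(\<Sum>s\<in>S. cinner y s *\<^sub>C s) \<in> complex_vector.span S"
      by (intro complex_vector.span_sum complex_vector.span_scale complex_vector.span_base)
    ultimately show False
      using y by (simp add: z_def)
  qed
  have z_orth: "cinner z s = 0" if "s \<in> S" for s
  proof -
    have "(\<Sum>t\<in>S. cinner y t * cinner t s) = (\<Sum>t\<in>S. if t = s then cinner y t else 0)"
      using assms(2) that by (intro sum.cong) (auto simp: orthonormal_def)
    then show ?thesis
      using \<open>finite S\<close> that
      by (simp add: z_def cinner_diff_left cinner_sum_left cinner_scaleC_left)
  qed
  define e where "e = complex_of_real (1 / norm z) *\<^sub>C z"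
  have e_orth: "cinner e s = 0" "cinner s e = 0" if "s \<in> S" for s
    using z_orth[OF that] cinner_commute[of s z]
    by (simp_all add: e_def cinner_scaleC_left cinner_scaleC_right)
  have e_unit: "cinner e e = 1"
    using \<open>z \<noteq> 0\<close>
    by (simp add: e_def cinner_self_norm norm_scaleC norm_divide)
  show ?thesis
  proof
    \<comment> \<open>A member of \<open>S\<close> would be orthogonal to \<open>e\<close>, but
      \<open>cinner e e = 1\<close>.\<close>
    show "e \<notin> S"
      using e_orth e_unit by auto
    then show "orthonormal (insert e S)"
      using assms(2) e_orth e_unit by (auto simp: orthonormal_def)
  qed
qed

lemma orthonormal_exists:
  assumes "enat n \<le> cdim (UNIV :: 'a::complex_inner set)"
  obtains S :: "'a::complex_inner set" where "finite S" "card S = n" "orthonormal S"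
proof -
  have "\<exists>S :: 'a set. finite S \<and> card S = n \<and> orthonormal S"
    using assms
  proof (induction n)
    case 0
    then show ?case
      by (intro exI[of _ "{}"]) (simp add: orthonormal_def)
  next
    case (Suc n)
    \<comment> \<open>In \<open>enat\<close>, \<open>Suc n\<close> being at most the dimension means
      that \<open>n\<close> is strictly below it; this serves both the induction hypothesis and the
      extension.\<close>
    have less: "enat n < cdim (UNIV :: 'a set)"
      using Suc.prems by (simp add: Suc_ile_eq)
    then obtain S :: "'a set" where S: "finite S" "card S = n" "orthonormal S"
      using Suc.IH[OF less_imp_le] by blast
    moreover obtain e where "e \<notin> S" "orthonormal (insert e S)"
      using orthonormal_extend[of S] S less by blast
    ultimately show ?case
      by (intro exI[of _ "insert e S"]) simp
  qed
  then show ?thesis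
    using that by blast
qed

lemma rank_one_triple_not_convex:
  fixes a b c d :: "'a::complex_inner" and T :: "3 \<Rightarrow> 'a \<Rightarrow> 'a"
  assumes dist: "distinct [a, b, c, d]" and orth: "orthonormal {a, b, c, d}"
    and T: "T 1 = (\<lambda>x. cinner x c *\<^sub>C a)" "T 2 = (\<lambda>x. cinner x d *\<^sub>C a)"
      "T 3 = (\<lambda>x. cinner x c *\<^sub>C b)"
  shows "\<not> convex (joint_numerical_range T)"
proof
  assume conv: "convex (joint_numerical_range T)"
  \<comment> \<open>\<open>r\<close> normalises the sum of two orthonormal vectors, and
    \<open>r * r\<close> is the value 1/2 in the two points below.\<close>
  define r where "r = complex_of_real (1 / sqrt 2)"
  have r: "cnj r = r" "r * r = 1 / 2"
    by (simp_all add: r_def flip: of_real_mult)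
  define P where "P = (\<lambda>s t :: 'a. r *\<^sub>C (s + t))"
  have range: "(\<chi> j. cinner (T j x) x) \<in> joint_numerical_range T" if "norm x = 1" for x
    using that by (auto simp: joint_numerical_range_def)
  note [simp] = cinner_add_left cinner_add_right cinner_scaleC_left cinner_scaleC_right r
  have on: "cinner x y = (if x = y then 1 else 0)"
    if "x \<in> {a, b, c, d}" "y \<in> {a, b, c, d}" for x y
    using orth that by (auto simp: orthonormal_def)
  have neq: "a \<noteq> b" "a \<noteq> c" "a \<noteq> d" "b \<noteq> c" "b \<noteq> d" "c \<noteq> d"
    using dist by auto
  note neq = neq neq[symmetric]
  have "cinner (P a d) (P a d) = 1" "cinner (P b c) (P b c) = 1"
    by (simp_all add: P_def on neq mult.left_commute[of r])
  then have "norm (P a d) = 1" "norm (P b c) = 1"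
    by (simp_all add: norm_eq_sqrt_cinner)
  \<comment> \<open>An entry survives only if the vector has components along both the input and the
    output direction of that operator: \<open>d\<close> and \<open>a\<close> for \<open>T 2\<close>,
    \<open>c\<close> and \<open>b\<close> for \<open>T 3\<close>.\<close>
  moreover have "(\<chi> j. cinner (T j (P a d)) (P a d)) = vector [0, 1/2, 0]"
    "(\<chi> j. cinner (T j (P b c)) (P b c)) = vector [0, 0, 1/2]"
    by (simp_all add: vec_eq_iff forall_3 T P_def on neq)
  ultimately have "vector [0, 1/2, 0] \<in> joint_numerical_range T"
    "vector [0, 0, 1/2] \<in> joint_numerical_range T"
    using range by metis+
  from convexD[OF conv this, of "1/2" "1/2"]
  obtain x where
    "(1/2) *\<^sub>R vector [0, 1/2, 0] + (1/2) *\<^sub>R vector [0, 0, 1/2] = (\<chi> j. cinner (T j x) x)"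
    by (auto simp: joint_numerical_range_def)
  \<comment> \<open>Entries of the midpoint (0, 1/4, 1/4). The factor \<open>cinner x c\<close> is
    shared by the first and third, \<open>cinner a x\<close> by the first and second, so the two
    inequalities contradict the equation.\<close>
  then have "cinner x c * cinner a x = 0" "cinner x d * cinner a x \<noteq> 0"
    "cinner x c * cinner b x \<noteq> 0"
    by (auto simp: vec_eq_iff forall_3 T)
  then show False
    by auto
qed

theorem theorem2p1:
  assumes "4 \<le> cdim (UNIV :: 'a::chilbert_space set)"
  shows "\<exists>T :: 3 \<Rightarrow> 'a \<Rightarrow> 'a.
           (\<forall>j. bounded_clinear (T j)) \<and>
           (\<forall>j k. T j \<circ> T k = T k \<circ> T j) \<and>
           \<not> convex (joint_numerical_range T)"
proof -
  obtain S :: "'a set" where "card S = 4" and S: "orthonormal S"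
    using orthonormal_exists[of 4, where 'a = 'a] assms by (auto simp: numeral_eq_enat)
  then obtain a b c d where Seq: "S = {a, b, c, d}" and dist: "distinct [a, b, c, d]"
    by (auto simp: numeral_eq_Suc card_Suc_eq)
  \<comment> \<open>\<open>f\<close> lists the input directions and \<open>g\<close> the output
    directions, so that one formula covers all three operators.\<close>
  define f :: "'a^3" where "f = vector [c, d, c]"
  define g :: "'a^3" where "g = vector [a, a, b]"
  define T where "T = (\<lambda>j x. cinner x (f $ j) *\<^sub>C (g $ j))"
  \<comment> \<open>\<open>T j (T k x)\<close> carries the factor
    \<open>cinner (g $ k) (f $ j)\<close>, so every product, squares included, is zero.\<close>
  have "\<forall>j k. cinner (g $ j) (f $ k) = 0"
    using S dist unfolding Seq by (auto simp: forall_3 f_def g_def orthonormal_def)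
  then have "\<forall>j k. T j \<circ> T k = T k \<circ> T j"
    by (simp add: T_def fun_eq_iff cinner_scaleC_left)
  moreover have "\<forall>j. bounded_clinear (T j)"
    by (simp add: T_def bounded_clinear_rank_one)
  moreover have "\<not> convex (joint_numerical_range T)"
    using S dist unfolding Seq
    by (intro rank_one_triple_not_convex[of a b c d]) (simp_all add: T_def f_def g_def)
  ultimately show ?thesis
    by blast
qed

end
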